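(* On a two-level substrate (level-$0$ capacity $S_0$, level-$0$ hold power $p_0$, fare $c_0$ per bit), any execution that computes exact causal attention over $T$ steps $\kappa$-atomically, with recomputation floor $\gamma_{\mathrm{rc}}$ and minimum inter-step time $\Delta t$, pays $$E\;\ge\;\kappa\,\frac{T(T-1)}{2}\,\gamma,\qquad \gamma=\min\big(c_0,\;\gamma_{\mathrm{rc}},\;p_0\,\Delta t\big),$$ with charges disjoint from the meetings' own operation energies.
   Context: Substrate. Storage consists of one-bit cells at a fast level $0$ holding at most $S_0$ bits, with hold power $p_0$ (energy per resident bit per unit time), and a slow level $1$; moving a bit across the boundary between them costs $c_0$. Operations fire at stations at level $0$, reading at most two words resident at level $0$ and writing at level $0$. An execution is a finite sequence of steps: holds (time advances; nothing is read, written, created or destroyed), moves (one bit is copied across the boundary into a free cell; the source stays), and fires (one operation; it may free live bits); moves and fires take no time. The energy $E$ is at least the energies of operations, plus $p_0$ times the integral over time of the number of bits resident at level $0$, plus $c_0$ times the number of boundary crossings of bits, dissipated in disjoint physical events. $\kappa$-atomic meetings. An execution computes exact causal attention over $T$ steps $\kappa$-atomically if it keeps representations of its past tokens that are pairwise disjoint as physical bits, of at least $\kappa$ bits each (token $t$'s representation being created at step $t$), and for every pair $t<t'$ (a meeting), step $t'$ performs operations that together read every bit of token $t$'s representation at level $0$; and it recomputes a representation, when it does, only along routes dissipating at least $\gamma_{\mathrm{rc}}$ per bit, meaning: every level-$0$ firing that writes bits of a representation, other than the one creating it, writes bits of no other representation and is either a copy (it reads the same bits of that representation from a level-$0$-resident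 copy) or belongs to a recomputation route; the non-copy firings are partitioned into routes, a route writes bits of one representation, all in its last firing, reads no bit of that representation, and dissipates at least $\gamma_{\mathrm{rc}}$ per bit it writes, counted per write. Steps are time-disjoint (every operation of step $t'$ follows every operation of step $t'-1$), and the inter-step time $\Delta t$ is the least time from the last operation of a step to the first of the next.
   Formalization: The meetings' own operation energies exclude firings that belong to a recomputation route; a route firing for one token may also read another token's bits in a meeting, and counting its energy both as charge and as the meeting's own would make the disjointness claim false. *)

theory Defs
  imports "HOL-Analysis.Analysis"
begin

text \<open>
  The type variable \<open>'c\<close> is the type of physical one-bit cells. Cells in \<open>level0\<close> form the fast
  level, all others the slow level 1. A cell is free iff it is not live; a bit resident at level 0
  is a live cell of \<open>level0\<close>. The field \<open>words\<close> says which sets of cells form a word.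
\<close>

record 'c substrate =
  level0 :: "'c set"
  words :: "'c set set"
  S0 :: nat
  p0 :: real
  c0 :: real

record 'c operation =
  op_reads :: "'c set"
  op_writes :: "'c set"
  op_frees :: "'c set"
  op_energy :: real

datatype 'c event = Hold real | Move 'c 'c | Fire (fired: "'c operation")

record 'c execution =
  initial_live :: "'c set"
  events :: "'c event list"

text \<open>\<open>Move a b\<close> copies the bit in \<open>a\<close> to \<open>b\<close>. A firing reads, then frees, then writes.\<close>

fun live_step :: "'c event \<Rightarrow> 'c set \<Rightarrow> 'c set" where
  "live_step (Hold d) L = L"
| "live_step (Move a b) L = insert b L"
| "live_step (Fire f) L = (L - op_frees f) \<union> op_writes f"

text \<open>State \<open>i\<close> is the state immediately before event \<open>i\<close> (events are numbered from 0).\<close>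

definition live :: "'c execution \<Rightarrow> nat \<Rightarrow> 'c set" where
  "live x i = fold live_step (take i (events x)) (initial_live x)"

fun admissible :: "'c substrate \<Rightarrow> 'c set \<Rightarrow> 'c event \<Rightarrow> bool" where
  "admissible S L (Hold d) \<longleftrightarrow> d \<ge> 0"
| "admissible S L (Move a b) \<longleftrightarrow> a \<in> L \<and> b \<notin> L \<and> (a \<in> level0 S \<longleftrightarrow> b \<notin> level0 S)"
| "admissible S L (Fire f) \<longleftrightarrow>
     (\<exists>W \<subseteq> words S. finite W \<and> card W \<le> 2 \<and> op_reads f = \<Union> W) \<and>
     op_reads f \<subseteq> L \<inter> level0 S \<and>
     op_frees f \<subseteq> L \<and>
     op_writes f \<subseteq> level0 S \<and> op_writes f \<inter> (L - op_frees f) = {} \<and>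
     op_energy f \<ge> 0"

definition execution_on :: "'c substrate \<Rightarrow> 'c execution \<Rightarrow> bool" where
  "execution_on S x \<longleftrightarrow>
     p0 S \<ge> 0 \<and> c0 S \<ge> 0 \<and>
     (\<forall>i < length (events x). admissible S (live x i) (events x ! i)) \<and>
     (\<forall>i \<le> length (events x).
        finite (live x i \<inter> level0 S) \<and> card (live x i \<inter> level0 S) \<le> S0 S)"

definition firings :: "'c execution \<Rightarrow> nat set" where
  "firings x = {i. i < length (events x) \<and> (\<exists>f. events x ! i = Fire f)}"

definition crossings :: "'c execution \<Rightarrow> nat set" where
  "crossings x = {i. i < length (events x) \<and> (\<exists>a b. events x ! i = Move a b)}"

definition operation_at :: "'c execution \<Rightarrow> nat \<Rightarrow> 'c operation" where
  "operation_at x i = fired (events x ! i)"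

definition clock :: "'c execution \<Rightarrow> nat \<Rightarrow> real" where
  "clock x i = (\<Sum>e\<leftarrow>take i (events x). case e of Hold d \<Rightarrow> d | _ \<Rightarrow> 0)"

text \<open>
  Several states share one instant when events take no time; the last of them is the one that
  persists.
\<close>

definition resident_at :: "'c substrate \<Rightarrow> 'c execution \<Rightarrow> real \<Rightarrow> nat" where
  "resident_at S x \<tau> =
     card (live x (Max {i. i \<le> length (events x) \<and> clock x i \<le> \<tau>}) \<inter> level0 S)"

definition accounted_energy :: "'c substrate \<Rightarrow> 'c execution \<Rightarrow> real" where
  "accounted_energy S x =
     (\<Sum>i\<in>firings x. op_energy (operation_at x i))
     + p0 S * integral {0..clock x (length (events x))} (\<lambda>\<tau>. real (resident_at S x \<tau>))
     + c0 S * real (card (crossings x))"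

text \<open>
  How an execution is read as an attention computation. The pair \<open>(t, b)\<close> stands for bit \<open>b\<close>
  of the representation of token \<open>t\<close>, where \<open>b < rep_size t\<close>. If event \<open>i\<close> is a firing, \<open>tag i c\<close>
  is the representation bit it writes into the cell \<open>c\<close>, or \<open>None\<close> for anything else. The
  sets \<open>step_ops t\<close> and the members of \<open>routes\<close> consist of event numbers, \<open>creator t\<close> is
  the event number of the firing that creates the representation of \<open>t\<close>.
\<close>

record 'c attention =
  rep_size :: "nat \<Rightarrow> nat"
  tag :: "nat \<Rightarrow> 'c \<Rightarrow> (nat \<times> nat) option"
  step_ops :: "nat \<Rightarrow> nat set"
  creator :: "nat \<Rightarrow> nat"
  routes :: "nat set set"

text \<open>
  The representation bit carried by each cell in state \<open>i\<close>. A cell carries at most one, so the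
  cells that carry different representations, or different bits of one, are always disjoint; one
  bit may have several copies.
\<close>

primrec content :: "'c execution \<Rightarrow> 'c attention \<Rightarrow> nat \<Rightarrow> 'c \<Rightarrow> (nat \<times> nat) option" where
  "content x A 0 = (\<lambda>c. None)"
| "content x A (Suc i) =
     (case events x ! i of
        Hold d \<Rightarrow> content x A i
      | Move a b \<Rightarrow> (content x A i)(b := content x A i a)
      | Fire f \<Rightarrow> (\<lambda>c. if c \<in> op_writes f then tag A i c
                       else if c \<in> op_frees f then None
                       else content x A i c))"

definition bits_read :: "'c execution \<Rightarrow> 'c attention \<Rightarrow> nat \<Rightarrow> (nat \<times> nat) set" where
  "bits_read x A i = {v. \<exists>c \<in> op_reads (operation_at x i). content x A i c = Some v}"

definition bits_written :: "'c execution \<Rightarrow> 'c attention \<Rightarrow> nat \<Rightarrow> (nat \<times> nat) set" where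
  "bits_written x A i = {v. \<exists>c \<in> op_writes (operation_at x i). tag A i c = Some v}"

text \<open>Counted per write: a bit written into two cells counts twice.\<close>

definition num_bit_writes :: "'c execution \<Rightarrow> 'c attention \<Rightarrow> nat \<Rightarrow> nat" where
  "num_bit_writes x A i = card {c \<in> op_writes (operation_at x i). tag A i c \<noteq> None}"

definition copy_firing :: "'c execution \<Rightarrow> 'c attention \<Rightarrow> nat \<Rightarrow> bool" where
  "copy_firing x A i \<longleftrightarrow> bits_written x A i \<subseteq> bits_read x A i"

text \<open>
  A route must write something: otherwise arbitrary firings could be declared to be routes.
\<close>

definition recomputation_route ::
    "'c execution \<Rightarrow> 'c attention \<Rightarrow> real \<Rightarrow> nat set \<Rightarrow> bool" where
  "recomputation_route x A \<gamma>rc r \<longleftrightarrow>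
     r \<noteq> {} \<and> r \<subseteq> firings x \<and>
     (\<exists>s. Max r \<noteq> creator A s \<and>
          bits_written x A (Max r) \<noteq> {} \<and> fst ` bits_written x A (Max r) \<subseteq> {s} \<and>
          (\<forall>i \<in> r - {Max r}. bits_written x A i = {}) \<and>
          (\<forall>i \<in> r. s \<notin> fst ` bits_read x A i) \<and>
          (\<Sum>i\<in>r. op_energy (operation_at x i)) \<ge> \<gamma>rc * real (num_bit_writes x A (Max r)))"

definition time_disjoint_steps :: "'c execution \<Rightarrow> 'c attention \<Rightarrow> nat \<Rightarrow> bool" where
  "time_disjoint_steps x A T \<longleftrightarrow>
     (\<forall>t \<in> {1..T}. step_ops A t \<subseteq> firings x) \<and>
     (\<forall>t \<in> {1..<T}. \<forall>i \<in> step_ops A t. \<forall>j \<in> step_ops A (Suc t). i < j)"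

definition keeps_representations ::
    "'c execution \<Rightarrow> 'c attention \<Rightarrow> nat \<Rightarrow> nat \<Rightarrow> bool" where
  "keeps_representations x A \<kappa> T \<longleftrightarrow>
     (\<forall>t \<in> {1..T}. \<kappa> \<le> rep_size A t) \<and>
     (\<forall>i \<in> firings x. bits_written x A i \<subseteq> (SIGMA t:{1..T}. {..<rep_size A t})) \<and>
     (\<forall>t \<in> {1..T}. creator A t \<in> step_ops A t \<and>
        {t} \<times> {..<rep_size A t} \<subseteq> bits_written x A (creator A t) \<and>
        (\<forall>i \<in> firings x. i < creator A t \<longrightarrow> t \<notin> fst ` bits_written x A i))"

text \<open>Only bits resident at level 0 can be read by a firing, see \<open>admissible\<close>.\<close>

definition meets :: "'c execution \<Rightarrow> 'c attention \<Rightarrow> nat \<Rightarrow> nat \<Rightarrow> bool" where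
  "meets x A t t' \<longleftrightarrow>
     {t} \<times> {..<rep_size A t} \<subseteq> (\<Union>i \<in> step_ops A t'. bits_read x A i)"

definition recomputes_with_floor ::
    "'c execution \<Rightarrow> 'c attention \<Rightarrow> real \<Rightarrow> bool" where
  "recomputes_with_floor x A \<gamma>rc \<longleftrightarrow>
     (\<forall>i \<in> firings x. \<forall>s \<in> fst ` bits_written x A i. i \<noteq> creator A s \<longrightarrow>
        fst ` bits_written x A i = {s} \<and> (copy_firing x A i \<or> i \<in> \<Union> (routes A))) \<and>
     disjoint (routes A) \<and>
     (\<forall>r \<in> routes A. recomputation_route x A \<gamma>rc r)"

definition kappa_atomic ::
    "'c execution \<Rightarrow> 'c attention \<Rightarrow> nat \<Rightarrow> nat \<Rightarrow> real \<Rightarrow> bool" where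
  "kappa_atomic x A \<kappa> T \<gamma>rc \<longleftrightarrow>
     time_disjoint_steps x A T \<and>
     keeps_representations x A \<kappa> T \<and>
     (\<forall>t t'. 1 \<le> t \<and> t < t' \<and> t' \<le> T \<longrightarrow> meets x A t t') \<and>
     recomputes_with_floor x A \<gamma>rc"

text \<open>Firings take no time, so \<open>clock\<close> at a firing is the instant of that firing.\<close>

definition inter_step_time :: "'c execution \<Rightarrow> 'c attention \<Rightarrow> nat \<Rightarrow> real" where
  "inter_step_time x A T =
     Min ((\<lambda>t. clock x (Min (step_ops A (Suc t))) - clock x (Max (step_ops A t))) ` {1..<T})"

text \<open>
  The operations of the meetings themselves. A route that recomputes one representation may read
  bits of another one; such a firing is recomputation, whose energy is available for the charges,
  and is therefore not among the meetings' own operations.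
\<close>

definition meeting_ops :: "'c execution \<Rightarrow> 'c attention \<Rightarrow> nat \<Rightarrow> nat set" where
  "meeting_ops x A T =
     {i. \<exists>t t'. 1 \<le> t \<and> t < t' \<and> t' \<le> T \<and> i \<in> step_ops A t' \<and> t \<in> fst ` bits_read x A i}
     - \<Union> (routes A)"

end

theory Submission
  imports Defs
begin

text \<open>
  Consider a bit of the representation of token \<open>t\<close> and a step \<open>m + 1\<close> with \<open>m \<ge> t\<close>.
  The bit is read at level 0 during step \<open>m + 1\<close>. Either it has had a copy at level 0 ever since
  the last operation of step \<open>m\<close>, which costs \<open>p0 * \<Delta>t\<close>, or there is a moment after that operation
  at which a copy appears at level 0 while there was none just before. The event of that moment is a
  boundary crossing carrying this bit, or a firing that is not a copy and hence ends a recomputation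
  route. The windows between the last operations of consecutive steps are disjoint, so that
  different triples of token, bit and step are charged to disjoint events.
\<close>

section \<open>States and time\<close>

lemma live_Suc:
  "i < length (events x) \<Longrightarrow> live x (Suc i) = live_step (events x ! i) (live x i)"
  by (simp add: live_def take_Suc_conv_app_nth)

lemma clock_0 [simp]: "clock x 0 = 0"
  by (simp add: clock_def)

lemma clock_Suc:
  "i < length (events x) \<Longrightarrow>
     clock x (Suc i) = clock x i + (case events x ! i of Hold d \<Rightarrow> d | _ \<Rightarrow> 0)"
  by (simp add: clock_def take_Suc_conv_app_nth)

lemma admissible_event:
  "execution_on S x \<Longrightarrow> i < length (events x) \<Longrightarrow> admissible S (live x i) (events x ! i)"
  by (simp add: execution_on_def)

lemma clock_le_Suc:
  assumes "execution_on S x" "i < length (events x)"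
  shows "clock x i \<le> clock x (Suc i)"
  using admissible_event[OF assms] clock_Suc[OF assms(2)]
  by (cases "events x ! i") auto

lemma clock_mono:
  assumes "execution_on S x" "i \<le> j" "j \<le> length (events x)"
  shows "clock x i \<le> clock x j"
  using assms(2,3)
proof (induction j rule: dec_induct)
  case (step j)
  then show ?case using clock_le_Suc[OF assms(1), of j] by simp
qed simp

lemma clock_Suc_firing: "i \<in> firings x \<Longrightarrow> clock x (Suc i) = clock x i"
  by (auto simp: firings_def clock_Suc)

lemma finite_firings [simp]: "finite (firings x)"
  by (simp add: firings_def)

lemma finite_crossings [simp]: "finite (crossings x)"
  by (simp add: crossings_def)

lemma op_energy_nonneg:
  assumes "execution_on S x" "i \<in> firings x"
  shows "0 \<le> op_energy (operation_at x i)"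
  using assms admissible_event[OF assms(1), of i] by (auto simp: firings_def operation_at_def)

text \<open>By monotonicity every later state has clock at least \<open>clock x (Suc i)\<close>, so
  \<open>i\<close> attains the maximum. For an event of zero duration the two bounds on
  \<open>\<tau>\<close> exclude each other.\<close>

lemma resident_at_eq:
  assumes "execution_on S x" "i < length (events x)" "clock x i \<le> \<tau>" "\<tau> < clock x (Suc i)"
  shows "resident_at S x \<tau> = card (live x i \<inter> level0 S)"
proof -
  have "Max {i. i \<le> length (events x) \<and> clock x i \<le> \<tau>} = i"
  proof (rule Max_eqI)
    fix j assume j: "j \<in> {i. i \<le> length (events x) \<and> clock x i \<le> \<tau>}"
    show "j \<le> i"
    proof (rule ccontr)
      assume "\<not> j \<le> i"
      then have "clock x (Suc i) \<le> clock x j"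
        using j by (intro clock_mono[OF assms(1)]) auto
      with j assms(4) show False by simp
    qed
  qed (use assms in auto)
  then show ?thesis by (simp add: resident_at_def)
qed

lemma has_integral_resident_at:
  assumes "execution_on S x" "n \<le> length (events x)"
  shows "((\<lambda>\<tau>. real (resident_at S x \<tau>)) has_integral
     (\<Sum>i<n. real (card (live x i \<inter> level0 S)) * (clock x (Suc i) - clock x i)))
     {0..clock x n}"
  using assms(2)
proof (induction n)
  case (Suc n)
  have le: "clock x n \<le> clock x (Suc n)"
    using clock_le_Suc[OF assms(1)] Suc.prems by simp
  have "((\<lambda>_. real (card (live x n \<inter> level0 S))) has_integral
      real (card (live x n \<inter> level0 S)) * (clock x (Suc n) - clock x n))
      {clock x n..clock x (Suc n)}"
    using has_integral_const_real[of "real (card (live x n \<inter> level0 S))"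
        "clock x n" "clock x (Suc n)"] le
    by (simp add: mult.commute)
  \<comment> \<open>At the right end point the resident count may already be that of a later state;
    a single point does not change the integral.\<close>
  then have "((\<lambda>\<tau>. real (resident_at S x \<tau>)) has_integral
      real (card (live x n \<inter> level0 S)) * (clock x (Suc n) - clock x n))
      {clock x n..clock x (Suc n)}"
  proof (rule has_integral_spike_finite[rotated -1, of _ _ _ "{clock x (Suc n)}"])
    fix \<tau> assume "\<tau> \<in> {clock x n..clock x (Suc n)} - {clock x (Suc n)}"
    then show "real (resident_at S x \<tau>) = real (card (live x n \<inter> level0 S))"
      using resident_at_eq[OF assms(1), of n \<tau>] Suc.prems by simp
  qed simp
  with Suc show ?case
    using has_integral_combine[OF _ le, of 0] clock_mono[OF assms(1), of 0 n] by simp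
qed (simp add: has_integral_refl)

lemma integral_resident_at:
  assumes "execution_on S x"
  shows "integral {0..clock x (length (events x))} (\<lambda>\<tau>. real (resident_at S x \<tau>)) =
     (\<Sum>i<length (events x). real (card (live x i \<inter> level0 S)) * (clock x (Suc i) - clock x i))"
  using has_integral_resident_at[OF assms order_refl] by (rule integral_unique)

section \<open>Representation bits at level 0\<close>

text \<open>Any copy counts: a bit may be passed between level-0 cells, so its continued presence is
  not tied to one cell.\<close>

definition at_level0 ::
    "'c substrate \<Rightarrow> 'c execution \<Rightarrow> 'c attention \<Rightarrow> nat \<Rightarrow> nat \<times> nat \<Rightarrow> bool" where
  "at_level0 S x A i v \<longleftrightarrow> (\<exists>c\<in>level0 S. content x A i c = Some v)"

lemma content_imp_live:
  "i \<le> length (events x) \<Longrightarrow> content x A i c = Some v \<Longrightarrow> c \<in> live x i"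
proof (induction i arbitrary: c)
  case (Suc i)
  then show ?case
    by (cases "events x ! i") (auto simp: live_Suc split: if_splits)
qed simp

text \<open>A cell carries at most one bit, so picking one carrier per bit gives an injection into
  the resident cells. This converts held bits into hold energy.\<close>

lemma card_at_level0_le:
  assumes "execution_on S x" "i \<le> length (events x)" "\<And>v. v \<in> V \<Longrightarrow> at_level0 S x A i v"
  shows "card V \<le> card (live x i \<inter> level0 S)"
proof -
  obtain f where f: "\<And>v. v \<in> V \<Longrightarrow> f v \<in> level0 S \<and> content x A i (f v) = Some v"
    using assms(3) unfolding at_level0_def by metis
  have "inj_on f V"
    by (rule inj_onI) (metis f option.inject)
  moreover have "f ` V \<subseteq> live x i \<inter> level0 S"
    using f content_imp_live[OF assms(2)] by blast
  moreover have "finite (live x i \<inter> level0 S)"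
    using assms(1,2) by (simp add: execution_on_def)
  ultimately show ?thesis by (rule card_inj_on_le)
qed

lemma at_level0_if_read:
  assumes "execution_on S x" "i \<in> firings x" "v \<in> bits_read x A i"
  shows "at_level0 S x A i v"
  using assms admissible_event[OF assms(1), of i]
  by (fastforce simp: firings_def operation_at_def bits_read_def at_level0_def)

text \<open>Holding and freeing never make a bit appear. A firing that writes \<open>v\<close> while
  no level-0 cell carries it cannot have read \<open>v\<close>, since firings read only at level 0;
  this rules out copies.\<close>

lemma appearance_at_level0:
  assumes "execution_on S x" "k < length (events x)"
    and "\<not> at_level0 S x A k v" "at_level0 S x A (Suc k) v"
  shows "(\<exists>a b. events x ! k = Move a b \<and> content x A k a = Some v) \<or>
         (k \<in> firings x \<and> v \<in> bits_written x A k \<and> \<not> copy_firing x A k)"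
proof (cases "events x ! k")
  case (Fire f)
  then have k: "k \<in> firings x" using assms(2) by (auto simp: firings_def)
  moreover have "v \<in> bits_written x A k"
    using assms(3,4) Fire
    by (auto simp: at_level0_def bits_written_def operation_at_def split: if_splits)
  moreover have "v \<notin> bits_read x A k"
    using at_level0_if_read[OF assms(1) k] assms(3) by blast
  ultimately show ?thesis by (auto simp: copy_firing_def)
qed (use assms(3,4) in \<open>auto simp: at_level0_def split: if_splits\<close>)

text \<open>Each written cell has at most one tag, so the bits written are an image of the tagged
  cells. Those are live at level 0 right after the firing, hence finite in number.\<close>

lemma card_bits_written_le:
  assumes "execution_on S x" "i \<in> firings x"
  shows "finite (bits_written x A i)" "card (bits_written x A i) \<le> num_bit_writes x A i"
proof -
  have sub: "op_writes (operation_at x i) \<subseteq> live x (Suc i) \<inter> level0 S"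
    using assms admissible_event[OF assms(1), of i]
    by (auto simp: firings_def operation_at_def live_Suc)
  moreover have "finite (live x (Suc i) \<inter> level0 S)"
    using assms by (simp add: execution_on_def firings_def)
  ultimately have fin: "finite {c \<in> op_writes (operation_at x i). tag A i c \<noteq> None}"
    by (metis (no_types, lifting) finite_subset mem_Collect_eq subsetI)
  have eq: "bits_written x A i =
      (the \<circ> tag A i) ` {c \<in> op_writes (operation_at x i). tag A i c \<noteq> None}"
    by (force simp: bits_written_def)
  show "finite (bits_written x A i)"
    unfolding eq using fin by (rule finite_imageI)
  show "card (bits_written x A i) \<le> num_bit_writes x A i"
    unfolding eq num_bit_writes_def using fin by (rule card_image_le)
qed

section \<open>Steps and their windows\<close>

definition last_op :: "'c attention \<Rightarrow> nat \<Rightarrow> nat" where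
  "last_op A t = Max (step_ops A t)"

definition first_op :: "'c attention \<Rightarrow> nat \<Rightarrow> nat" where
  "first_op A t = Min (step_ops A t)"

locale attention_execution =
  fixes S :: "'c substrate" and x :: "'c execution" and A :: "'c attention"
    and \<kappa> T :: nat and \<gamma>rc :: real
  assumes execution: "execution_on S x"
    and atomic: "kappa_atomic x A \<kappa> T \<gamma>rc"
begin

text \<open>The creator belongs to its step, so the \<open>Max\<close> and \<open>Min\<close> of the
  step's operations are attained.\<close>

lemma step_ops:
  assumes "t \<in> {1..T}"
  shows "step_ops A t \<subseteq> firings x" "finite (step_ops A t)" "step_ops A t \<noteq> {}"
    "creator A t \<in> step_ops A t"
proof -
  show "step_ops A t \<subseteq> firings x"
    using atomic assms by (simp add: kappa_atomic_def time_disjoint_steps_def)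
  then show "finite (step_ops A t)"
    by (rule finite_subset) simp
  show "creator A t \<in> step_ops A t"
    using atomic assms by (simp add: kappa_atomic_def keeps_representations_def)
  then show "step_ops A t \<noteq> {}" by blast
qed

lemma first_op_in: "t \<in> {1..T} \<Longrightarrow> first_op A t \<in> step_ops A t"
  using step_ops by (simp add: first_op_def)

lemma last_op_in: "t \<in> {1..T} \<Longrightarrow> last_op A t \<in> step_ops A t"
  using step_ops by (simp add: last_op_def)

lemma first_op_le: "t \<in> {1..T} \<Longrightarrow> i \<in> step_ops A t \<Longrightarrow> first_op A t \<le> i"
  using step_ops by (simp add: first_op_def)

lemma le_last_op: "t \<in> {1..T} \<Longrightarrow> i \<in> step_ops A t \<Longrightarrow> i \<le> last_op A t"
  using step_ops by (simp add: last_op_def)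

lemma last_op_less_length: "t \<in> {1..T} \<Longrightarrow> last_op A t < length (events x)"
  using last_op_in step_ops(1) by (fastforce simp: firings_def)

lemma last_op_less_first_op: "m \<in> {1..<T} \<Longrightarrow> last_op A m < first_op A (Suc m)"
  using atomic last_op_in[of m] first_op_in[of "Suc m"]
  by (auto simp: kappa_atomic_def time_disjoint_steps_def)

lemma last_op_mono:
  assumes "1 \<le> s" "s \<le> t" "t \<le> T"
  shows "last_op A s \<le> last_op A t"
  using assms(2,3)
proof (induction t rule: dec_induct)
  case (step t)
  then have "last_op A t < first_op A (Suc t)"
    using assms(1) by (intro last_op_less_first_op) auto
  also have "\<dots> \<le> last_op A (Suc t)"
    using step assms(1) by (intro le_last_op first_op_in) auto
  finally show ?case using step by simp
qed simp

text \<open>Consecutive windows share only an end point, which the open intervals omit. An event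
  thus determines the step for which it is charged.\<close>

lemma window_unique:
  assumes "m \<in> {1..<T}" "n \<in> {1..<T}"
    and "k \<in> {last_op A m<..<last_op A (Suc m)}" "k \<in> {last_op A n<..<last_op A (Suc n)}"
  shows "m = n"
proof (rule linorder_cases)
  assume "m < n"
  then have "last_op A (Suc m) \<le> last_op A n"
    using assms by (intro last_op_mono) auto
  with assms show ?thesis by simp
next
  assume "n < m"
  then have "last_op A (Suc n) \<le> last_op A m"
    using assms by (intro last_op_mono) auto
  with assms show ?thesis by simp
qed

text \<open>The creation of \<open>t\<close> happens in step \<open>t\<close>, hence no later than
  \<open>last_op A m\<close>. So \<open>k\<close> neither creates nor copies and must lie on a
  route; as only the last firing of a route writes representation bits, \<open>k\<close> is that
  one.\<close>

lemma firing_in_window: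
  assumes "k \<in> firings x" "(t, b) \<in> bits_written x A k" "\<not> copy_firing x A k"
    and "1 \<le> t" "t \<le> m" "m < T" "last_op A m < k"
  shows "\<exists>r\<in>routes A. Max r = k"
proof -
  have "creator A t \<le> last_op A t"
    using assms by (intro le_last_op step_ops) auto
  also have "\<dots> \<le> last_op A m"
    using assms by (intro last_op_mono) auto
  finally have "k \<noteq> creator A t" using assms by simp
  moreover have "t \<in> fst ` bits_written x A k"
    using assms(2) by force
  ultimately obtain r where r: "r \<in> routes A" "k \<in> r"
    using atomic assms(1,3) unfolding kappa_atomic_def recomputes_with_floor_def by blast
  then have "recomputation_route x A \<gamma>rc r"
    using atomic by (auto simp: kappa_atomic_def recomputes_with_floor_def)
  then have "\<forall>i\<in>r - {Max r}. bits_written x A i = {}"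
    by (auto simp: recomputation_route_def)
  with r assms(2) show ?thesis by fastforce
qed

section \<open>Charging the meetings\<close>

text \<open>The triple \<open>(m, t, b)\<close> stands for the reading of bit \<open>(t, b)\<close> in step \<open>m + 1\<close>.\<close>

definition meeting_bits :: "(nat \<times> nat \<times> nat) set" where
  "meeting_bits = (SIGMA m:{1..<T}. {1..m} \<times> {..<\<kappa>})"

text \<open>State \<open>i\<close> precedes event \<open>i\<close>, so the range runs from the state
  right after the last operation of step \<open>m\<close> to the one right before the first
  operation of step \<open>m + 1\<close>.\<close>

definition held :: "nat \<Rightarrow> (nat \<times> nat) set" where
  "held m = {v \<in> {1..m} \<times> {..<\<kappa>}.
     \<forall>i\<in>{last_op A m<..first_op A (Suc m)}. at_level0 S x A i v}"

text \<open>The window reaches to the last operation of step \<open>m + 1\<close>, since a bit may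
  be fetched between the operations of that step. Naming the content of the source cell makes the
  crossing determine \<open>v\<close>.\<close>

definition crossed :: "(nat \<times> nat \<times> nat) set" where
  "crossed = {(m, v). (m, v) \<in> meeting_bits \<and>
     (\<exists>k\<in>{last_op A m<..<last_op A (Suc m)}. k < length (events x) \<and>
        (\<exists>a b. events x ! k = Move a b \<and> content x A k a = Some v))}"

text \<open>A route is assigned to the window of its last firing, where all its writes occur; its
  other firings may lie in earlier windows.\<close>

definition recomputed :: "(nat \<times> nat \<times> nat) set" where
  "recomputed = {(m, v). (m, v) \<in> meeting_bits \<and>
     (\<exists>r\<in>routes A. Max r \<in> {last_op A m<..<last_op A (Suc m)} \<and> v \<in> bits_written x A (Max r))}"

section \<open>The number of meeting bits and their three kinds\<close>

lemma finite_meeting_bits: "finite meeting_bits"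
  by (simp add: meeting_bits_def)

lemma card_meeting_bits: "real (card meeting_bits) = real \<kappa> * (real T * (real T - 1) / 2)"
proof -
  have "card meeting_bits = (\<Sum>m\<in>{1..<T}. m * \<kappa>)"
    by (simp add: meeting_bits_def)
  also have "real \<dots> = real \<kappa> * (\<Sum>m\<in>{1..<T}. real m)"
    by (simp add: sum_distrib_left mult.commute)
  \<comment> \<open>The subtraction is real, so \<open>T = 0\<close> gives 0 on both sides. The
    induction step splits off \<open>n = 0\<close>, where the range is still empty.\<close>
  also have "(\<Sum>m\<in>{1..<T}. real m) = real T * (real T - 1) / 2"
  proof (induction T)
    case (Suc n)
    then show ?case by (cases n) (auto simp: field_simps)
  qed simp
  finally show ?thesis .
qed

lemma finite_held: "finite (held m)"
  by (rule finite_subset[of _ "{1..m} \<times> {..<\<kappa>}"]) (auto simp: held_def)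

lemma meeting_bit_charged:
  assumes "(m, v) \<in> meeting_bits"
  shows "(m, v) \<in> (SIGMA m:{1..<T}. held m) \<union> crossed \<union> recomputed"
proof -
  obtain t b where v: "v = (t, b)" and m: "m \<in> {1..<T}" and t: "1 \<le> t" "t \<le> m" and b: "b < \<kappa>"
    using assms by (auto simp: meeting_bits_def)
  \<comment> \<open>Representations may be larger than \<open>\<kappa>\<close> bits and of different
    sizes; only the first \<open>\<kappa>\<close> bits of each are counted.\<close>
  have "\<kappa> \<le> rep_size A t"
    using atomic m t by (auto simp: kappa_atomic_def keeps_representations_def)
  moreover have "meets x A t (Suc m)"
    using atomic m t by (auto simp: kappa_atomic_def)
  ultimately have "v \<in> (\<Union>i\<in>step_ops A (Suc m). bits_read x A i)"
    using b unfolding meets_def v by (meson SigmaI lessThan_iff less_le_trans singletonI subsetD)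
  then obtain i where i: "i \<in> step_ops A (Suc m)" "v \<in> bits_read x A i"
    by blast
  have "i \<in> firings x"
    using i(1) step_ops(1)[of "Suc m"] m by auto
  then have top: "at_level0 S x A i v"
    using i(2) by (intro at_level0_if_read execution)
  have bounds: "first_op A (Suc m) \<le> i" "i \<le> last_op A (Suc m)" "i < length (events x)"
    using i(1) m \<open>i \<in> firings x\<close>
    by (auto intro: first_op_le le_last_op simp: firings_def)
  show ?thesis
  proof (cases "\<forall>j\<in>{last_op A m<..first_op A (Suc m)}. at_level0 S x A j v")
    case True
    then have "v \<in> held m" using t b by (simp add: held_def v)
    with m show ?thesis by simp
  next
    case False
    then obtain j where j: "last_op A m < j" "j \<le> i" "\<not> at_level0 S x A j v"
      using bounds by auto
    \<comment> \<open>A discrete intermediate value argument: absence at \<open>j\<close> and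
      presence at the reading \<open>i\<close> force a switch in between. As \<open>i\<close> need
      not be the first operation of its step, the switch may fall inside the step.\<close>
    obtain k where k: "j \<le> k" "k < i" "\<not> at_level0 S x A k v" "at_level0 S x A (Suc k) v"
    proof -
      have "\<exists>k. j \<le> k \<and> k < i \<and> \<not> at_level0 S x A k v \<and> at_level0 S x A (Suc k) v"
      proof (rule ccontr)
        assume *: "\<not> ?thesis"
        from j(2) have "\<not> at_level0 S x A i v"
        proof (induction "i" rule: dec_induct)
          case base
          show ?case by (rule j(3))
        next
          case (step n)
          then show ?case using * by auto
        qed
        with top show False by simp
      qed
      with that show ?thesis by blast
    qed
    have window: "k \<in> {last_op A m<..<last_op A (Suc m)}" "k < length (events x)"
      using j k bounds by auto
    from appearance_at_level0[OF execution window(2) k(3,4)] show ?thesis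
    proof
      assume "\<exists>a b. events x ! k = Move a b \<and> content x A k a = Some v"
      then have "(m, v) \<in> crossed"
        using window assms by (auto simp: crossed_def)
      then show ?thesis by simp
    next
      assume "k \<in> firings x \<and> v \<in> bits_written x A k \<and> \<not> copy_firing x A k"
      then have "\<exists>r\<in>routes A. Max r = k"
        using firing_in_window[of k t b m] t m window(1) by (auto simp: v)
      then have "(m, v) \<in> recomputed"
        using window assms \<open>k \<in> firings x \<and> _\<close> by (auto simp: recomputed_def)
      then show ?thesis by simp
    qed
  qed
qed

section \<open>Bounding each kind by the events charged for it\<close>

lemma card_meeting_bits_le:
  "card meeting_bits \<le> (\<Sum>m\<in>{1..<T}. card (held m)) + card crossed + card recomputed"
proof -
  have fin: "finite crossed" "finite recomputed"
    by (rule finite_subset[OF _ finite_meeting_bits]; auto simp: crossed_def recomputed_def)+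
  have "card meeting_bits \<le> card ((SIGMA m:{1..<T}. held m) \<union> crossed \<union> recomputed)"
    using meeting_bit_charged fin by (intro card_mono) (auto simp: finite_held simp del: Un_iff)
  also have "\<dots> \<le> card (SIGMA m:{1..<T}. held m) + card crossed + card recomputed"
    by (meson add_mono card_Un_le order_refl order_trans)
  finally show ?thesis by (simp add: finite_held)
qed

text \<open>Choosing a crossing for each triple is injective: the window containing the event gives
  the step, the content of its source cell gives the bit.\<close>

lemma card_crossed_le: "card crossed \<le> card (crossings x)"
proof -
  have "\<forall>u\<in>crossed. \<exists>k. k \<in> {last_op A (fst u)<..<last_op A (Suc (fst u))} \<and>
      k < length (events x) \<and> (\<exists>a b. events x ! k = Move a b \<and> content x A k a = Some (snd u))"
    by (auto simp: crossed_def)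
  then obtain f where f: "\<And>u. u \<in> crossed \<Longrightarrow>
      f u \<in> {last_op A (fst u)<..<last_op A (Suc (fst u))} \<and> f u < length (events x) \<and>
      (\<exists>a b. events x ! f u = Move a b \<and> content x A (f u) a = Some (snd u))"
    by metis
  have "inj_on f crossed"
  proof (rule inj_onI)
    fix u w assume u: "u \<in> crossed" and w: "w \<in> crossed" and eq: "f u = f w"
    have "fst u \<in> {1..<T}" "fst w \<in> {1..<T}"
      using u w by (auto simp: crossed_def meeting_bits_def)
    then have "fst u = fst w"
      using f[OF u] f[OF w] eq by (metis window_unique)
    moreover have "snd u = snd w"
      using f[OF u] f[OF w] eq by auto
    ultimately show "u = w" by (rule prod_eqI)
  qed
  moreover have "f ` crossed \<subseteq> crossings x"
    using f by (fastforce simp: crossings_def)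
  ultimately show ?thesis using finite_crossings by (rule card_inj_on_le)
qed

lemma route:
  assumes "r \<in> routes A"
  shows "r \<subseteq> firings x" "finite r" "Max r \<in> firings x"
    "\<gamma>rc * real (num_bit_writes x A (Max r)) \<le> (\<Sum>i\<in>r. op_energy (operation_at x i))"
proof -
  have r: "recomputation_route x A \<gamma>rc r"
    using atomic assms by (auto simp: kappa_atomic_def recomputes_with_floor_def)
  then show sub: "r \<subseteq> firings x"
    and "\<gamma>rc * real (num_bit_writes x A (Max r)) \<le> (\<Sum>i\<in>r. op_energy (operation_at x i))"
    by (auto simp: recomputation_route_def)
  from sub show fin: "finite r" by (rule finite_subset) simp
  have "r \<noteq> {}" using r by (simp add: recomputation_route_def)
  with fin sub show "Max r \<in> firings x" using Max_in by blast
qed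

lemma finite_routes: "finite (routes A)"
  by (rule finite_subset[of _ "Pow (firings x)"]) (use route(1) in auto)

text \<open>One route may restore several bits, so a triple is recovered from a route together with
  a bit; the window of the route's last firing gives the step. The floor is counted per write, which
  dominates the number of distinct bits.\<close>

lemma card_recomputed_le:
  "card recomputed \<le> (\<Sum>r\<in>routes A. num_bit_writes x A (Max r))"
proof -
  have "\<forall>u\<in>recomputed. \<exists>r\<in>routes A. Max r \<in> {last_op A (fst u)<..<last_op A (Suc (fst u))} \<and>
      snd u \<in> bits_written x A (Max r)"
    by (auto simp: recomputed_def)
  then obtain f where f: "\<And>u. u \<in> recomputed \<Longrightarrow> f u \<in> routes A \<and>
      Max (f u) \<in> {last_op A (fst u)<..<last_op A (Suc (fst u))} \<and>
      snd u \<in> bits_written x A (Max (f u))"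
    by metis
  have "inj_on (\<lambda>u. (f u, snd u)) recomputed"
  proof (rule inj_onI)
    fix u w assume u: "u \<in> recomputed" and w: "w \<in> recomputed"
      and eq: "(f u, snd u) = (f w, snd w)"
    have "fst u \<in> {1..<T}" "fst w \<in> {1..<T}"
      using u w by (auto simp: recomputed_def meeting_bits_def)
    then have "fst u = fst w"
      using f[OF u] f[OF w] eq by (metis window_unique prod.inject)
    with eq show "u = w" by (simp add: prod_eqI)
  qed
  moreover have "(\<lambda>u. (f u, snd u)) ` recomputed \<subseteq>
      (SIGMA r:routes A. bits_written x A (Max r))"
    using f by auto
  moreover have fin: "finite (bits_written x A (Max r))" if "r \<in> routes A" for r
    using card_bits_written_le(1)[OF execution route(3)[OF that]] .
  then have "finite (SIGMA r:routes A. bits_written x A (Max r))"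
    using finite_routes by blast
  ultimately have "card recomputed \<le> card (SIGMA r:routes A. bits_written x A (Max r))"
    by (rule card_inj_on_le)
  also have "\<dots> = (\<Sum>r\<in>routes A. card (bits_written x A (Max r)))"
    using finite_routes fin by simp
  also have "\<dots> \<le> (\<Sum>r\<in>routes A. num_bit_writes x A (Max r))"
    using card_bits_written_le(2)[OF execution route(3)] by (rule sum_mono)
  finally show ?thesis .
qed

section \<open>Energy of firings and of residence at level 0\<close>

lemma meeting_ops_firings: "meeting_ops x A T \<subseteq> firings x"
proof
  fix i assume "i \<in> meeting_ops x A T"
  then obtain t t' where "1 \<le> t" "t < t'" "t' \<le> T" and i: "i \<in> step_ops A t'"
    by (auto simp: meeting_ops_def)
  then have "t' \<in> {1..T}" by simp
  with i show "i \<in> firings x" using step_ops(1) by blast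
qed

text \<open>Routes are pairwise disjoint and \<open>meeting_ops\<close> excludes them, so these
  energies add up without overlap; all other firings contribute nonnegative amounts.\<close>

lemma firing_energy_ge:
  "(\<Sum>i\<in>meeting_ops x A T. op_energy (operation_at x i)) +
     \<gamma>rc * real (\<Sum>r\<in>routes A. num_bit_writes x A (Max r))
   \<le> (\<Sum>i\<in>firings x. op_energy (operation_at x i))"
proof -
  let ?e = "\<lambda>i. op_energy (operation_at x i)"
  have sub: "\<Union> (routes A) \<subseteq> firings x"
    using route(1) by blast
  have fin: "finite (meeting_ops x A T)" "finite (\<Union> (routes A))"
    using meeting_ops_firings sub by (blast intro: finite_subset[OF _ finite_firings])+
  have "\<gamma>rc * real (\<Sum>r\<in>routes A. num_bit_writes x A (Max r)) \<le> (\<Sum>r\<in>routes A. sum ?e r)"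
    by (simp add: sum_distrib_left sum_mono route(4))
  also have "\<dots> = sum ?e (\<Union> (routes A))"
    using atomic route(2)
    by (subst sum.Union_disjoint)
      (auto simp: kappa_atomic_def recomputes_with_floor_def disjoint_def)
  finally have "sum ?e (meeting_ops x A T) +
      \<gamma>rc * real (\<Sum>r\<in>routes A. num_bit_writes x A (Max r)) \<le>
      sum ?e (meeting_ops x A T) + sum ?e (\<Union> (routes A))"
    by simp
  also have "\<dots> = sum ?e (meeting_ops x A T \<union> \<Union> (routes A))"
    using fin by (subst sum.union_disjoint) (auto simp: meeting_ops_def)
  also have "\<dots> \<le> sum ?e (firings x)"
    using meeting_ops_firings sub op_energy_nonneg[OF execution] by (intro sum_mono2) auto
  finally show ?thesis .
qed

text \<open>Serves the case of a nonpositive \<open>\<gamma>\<close>: if \<open>\<gamma>rc\<close>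
  is negative, \<open>firing_energy_ge\<close> does not yield this bound.\<close>

lemma meeting_energy_le_firing_energy:
  "(\<Sum>i\<in>meeting_ops x A T. op_energy (operation_at x i))
   \<le> (\<Sum>i\<in>firings x. op_energy (operation_at x i))"
  using meeting_ops_firings op_energy_nonneg[OF execution] by (intro sum_mono2) auto

text \<open>Throughout the gap after step \<open>m\<close> there are at least
  \<open>card (held m)\<close> resident cells, and the gap lasts at least the inter-step time.
  Different gaps are disjoint, so their contributions add up within the integral.\<close>

lemma residence_ge:
  "(\<Sum>m\<in>{1..<T}. real (card (held m))) * inter_step_time x A T \<le>
   integral {0..clock x (length (events x))} (\<lambda>\<tau>. real (resident_at S x \<tau>))"
proof -
  let ?r = "\<lambda>i. real (card (live x i \<inter> level0 S)) * (clock x (Suc i) - clock x i)"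
  \<comment> \<open>These are the events strictly between two steps. The last operation of step
    \<open>m\<close> takes no time, so starting one event later loses none of the gap.\<close>
  let ?I = "\<lambda>m. {Suc (last_op A m)..<first_op A (Suc m)}"
  have first: "first_op A (Suc m) \<le> last_op A (Suc m)"
    "first_op A (Suc m) < length (events x)" if "m \<in> {1..<T}" for m
    using that le_last_op[of "Suc m"] first_op_in[of "Suc m"] last_op_less_length[of "Suc m"]
    by force+
  have gap: "real (card (held m)) * inter_step_time x A T \<le> sum ?r (?I m)"
    if m: "m \<in> {1..<T}" for m
  proof -
    have "last_op A m \<in> firings x"
      using m last_op_in step_ops(1) by fastforce
    then have start: "clock x (Suc (last_op A m)) = clock x (last_op A m)"
      by (rule clock_Suc_firing)
    have "inter_step_time x A T \<le> clock x (first_op A (Suc m)) - clock x (last_op A m)"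
      using m unfolding inter_step_time_def first_op_def last_op_def by (intro Min_le) auto
    also have "\<dots> = (\<Sum>i\<in>?I m. clock x (Suc i) - clock x i)"
      using sum_Suc_diff'[of "Suc (last_op A m)" "first_op A (Suc m)" "clock x"]
        last_op_less_first_op[OF m] start by simp
    finally have "real (card (held m)) * inter_step_time x A T \<le>
        (\<Sum>i\<in>?I m. real (card (held m)) * (clock x (Suc i) - clock x i))"
      by (simp add: mult_left_mono flip: sum_distrib_left)
    also have "\<dots> \<le> sum ?r (?I m)"
    proof (rule sum_mono)
      fix i assume i: "i \<in> ?I m"
      then have len: "i < length (events x)" using first(2)[OF m] by simp
      have "card (held m) \<le> card (live x i \<inter> level0 S)"
        using i len by (intro card_at_level0_le[OF execution, where A = A]) (auto simp: held_def)
      then show "real (card (held m)) * (clock x (Suc i) - clock x i) \<le> ?r i"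
        using clock_le_Suc[OF execution len] by (intro mult_right_mono) auto
    qed
    finally show ?thesis .
  qed
  have "(\<Sum>m\<in>{1..<T}. real (card (held m))) * inter_step_time x A T \<le> (\<Sum>m\<in>{1..<T}. sum ?r (?I m))"
    unfolding sum_distrib_right by (intro sum_mono gap)
  also have "\<dots> = sum ?r (\<Union>m\<in>{1..<T}. ?I m)"
  proof (rule sum.UNION_disjoint[symmetric]; (intro ballI impI)?)
    fix m n assume mn: "m \<in> {1..<T}" "n \<in> {1..<T}" "m \<noteq> n"
    have "?I m \<subseteq> {last_op A m<..<last_op A (Suc m)}" "?I n \<subseteq> {last_op A n<..<last_op A (Suc n)}"
      using mn first(1) by fastforce+
    then show "?I m \<inter> ?I n = {}"
      using window_unique[OF mn(1,2)] mn(3) by blast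
  qed simp_all
  also have "\<dots> \<le> sum ?r {..<length (events x)}"
  proof (rule sum_mono2)
    show "(\<Union>m\<in>{1..<T}. ?I m) \<subseteq> {..<length (events x)}"
      using first(2) by fastforce
    show "0 \<le> ?r i" if "i \<in> {..<length (events x)} - (\<Union>m\<in>{1..<T}. ?I m)" for i
      using that clock_le_Suc[OF execution, of i] by simp
  qed simp
  finally show ?thesis
    by (simp add: integral_resident_at[OF execution])
qed

section \<open>The total energy\<close>

lemma residence_nonneg:
  "0 \<le> integral {0..clock x (length (events x))} (\<lambda>\<tau>. real (resident_at S x \<tau>))"
  unfolding integral_resident_at[OF execution]
  using clock_le_Suc[OF execution] by (intro sum_nonneg mult_nonneg_nonneg) auto

lemma accounted_energy_ge:
  assumes "\<gamma> \<le> c0 S" "\<gamma> \<le> \<gamma>rc" "\<gamma> \<le> p0 S * inter_step_time x A T"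
  shows "(\<Sum>i\<in>meeting_ops x A T. op_energy (operation_at x i)) + real (card meeting_bits) * \<gamma>
    \<le> accounted_energy S x"
proof -
  let ?int = "integral {0..clock x (length (events x))} (\<lambda>\<tau>. real (resident_at S x \<tau>))"
  let ?h = "\<Sum>m\<in>{1..<T}. real (card (held m))"
  let ?w = "real (\<Sum>r\<in>routes A. num_bit_writes x A (Max r))"
  have p0: "0 \<le> p0 S" and c0: "0 \<le> c0 S"
    using execution by (auto simp: execution_on_def)
  \<comment> \<open>The count of triples can be scaled by \<open>\<gamma>\<close> only if
    \<open>\<gamma>\<close> is nonnegative. Otherwise the claimed charge is at most zero, and
    nonnegative hold and crossing energies suffice.\<close>
  show ?thesis
  proof (cases "\<gamma> \<le> 0")
    case True
    then have "real (card meeting_bits) * \<gamma> \<le> 0"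
      by (simp add: mult_nonneg_nonpos)
    moreover have "0 \<le> p0 S * ?int" "0 \<le> c0 S * real (card (crossings x))"
      using p0 c0 residence_nonneg by simp_all
    ultimately show ?thesis
      using meeting_energy_le_firing_energy unfolding accounted_energy_def by linarith
  next
    case False
    have "real (card meeting_bits) \<le>
        real ((\<Sum>m\<in>{1..<T}. card (held m)) + card crossed + card recomputed)"
      using card_meeting_bits_le by (rule of_nat_mono)
    also have "\<dots> \<le> ?h + real (card (crossings x)) + ?w"
      using card_crossed_le card_recomputed_le
      by (simp flip: of_nat_sum)
    finally have "real (card meeting_bits) * \<gamma> \<le>
        (?h + real (card (crossings x)) + ?w) * \<gamma>"
      using False by (intro mult_right_mono) auto
    \<comment> \<open>For \<open>T \<le> 1\<close> the inter-step time is a \<open>Min\<close> over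
      the empty set and has no known value; then \<open>?h\<close> is an empty sum and the bound
      still holds.\<close>
    moreover have "?h * \<gamma> \<le> p0 S * ?int"
    proof -
      have "?h * \<gamma> \<le> ?h * (p0 S * inter_step_time x A T)"
        using assms(3) by (intro mult_left_mono sum_nonneg) auto
      also have "\<dots> = p0 S * (?h * inter_step_time x A T)"
        by (simp only: mult_ac)
      also have "\<dots> \<le> p0 S * ?int"
        using residence_ge p0 by (rule mult_left_mono)
      finally show ?thesis .
    qed
    moreover have "real (card (crossings x)) * \<gamma> \<le> c0 S * real (card (crossings x))"
      using assms(1) by (subst mult.commute) (intro mult_right_mono, auto)
    moreover have "?w * \<gamma> \<le> \<gamma>rc * ?w"
      using assms(2) by (subst mult.commute) (intro mult_right_mono of_nat_0_le_iff)
    ultimately show ?thesis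
      using firing_energy_ge unfolding accounted_energy_def distrib_right by linarith
  qed
qed

lemma meeting_energy_nonneg: "0 \<le> (\<Sum>i\<in>meeting_ops x A T. op_energy (operation_at x i))"
  using meeting_ops_firings op_energy_nonneg[OF execution] by (intro sum_nonneg) auto

end

theorem theorem4:
  fixes S :: "'c substrate" and x :: "'c execution" and A :: "'c attention"
    and \<kappa> T :: nat and E \<gamma>rc \<Delta>t \<gamma> :: real
  assumes "execution_on S x"
    and "kappa_atomic x A \<kappa> T \<gamma>rc"
    and "E \<ge> accounted_energy S x"
    and "\<Delta>t = inter_step_time x A T"
    and "\<gamma> = min (c0 S) (min \<gamma>rc (p0 S * \<Delta>t))"
  shows "E \<ge> real \<kappa> * (real T * (real T - 1) / 2) * \<gamma> \<and>
         E \<ge> (\<Sum>i\<in>meeting_ops x A T. op_energy (operation_at x i))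
               + real \<kappa> * (real T * (real T - 1) / 2) * \<gamma>"
proof -
  interpret attention_execution S x A \<kappa> T \<gamma>rc
    using assms(1,2) by unfold_locales
  have "(\<Sum>i\<in>meeting_ops x A T. op_energy (operation_at x i)) + real (card meeting_bits) * \<gamma>
      \<le> accounted_energy S x"
    using assms(4,5) by (intro accounted_energy_ge) auto
  \<comment> \<open>The bound without the meetings' own energies follows from the one with them, as
    these energies are nonnegative.\<close>
  then show ?thesis
    using assms(3) meeting_energy_nonneg unfolding card_meeting_bits by linarith
qed

end
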